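(* Let $S$ be a Hausdorff sequential countably compact topological semigroup. Then the following conditions hold: (i) each maximal subgroup $H(e)$, $e\in E(S)$, is closed in $S$; (ii) the subset $H(S)$ is closed in $S$; (iii) the inversion $\operatorname{inv}\colon H(S)\to H(S)$ is continuous; (iv) the projection $\pi\colon H(S)\to E(S)$ is continuous.
   Context: A topological semigroup is a topological space with a continuous associative binary operation. A space $X$ is countably compact if every countable open cover of $X$ has a finite subcover. A space $X$ is sequential if each non-closed subset $A$ of $X$ contains a sequence of points converging to some point of $X\setminus A$. $E(S)$ denotes the set of idempotents of a semigroup $S$; for $e\in E(S)$, $H(e)$ is the maximal subgroup of $S$ with identity $e$; $H(S)=\bigcup_{e\in E(S)}H(e)$. The inversion $\operatorname{inv}\colon H(S)\to H(S)$ sends $x\in H(e)$ to its inverse $x^{-1}$ in the group $H(e)$, and the projection $\pi\colon H(S)\to E(S)$ is $\pi(x)=xx^{-1}$. Here $H(S)$ and $E(S)$ carry the subspace topologies from $S$. *)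

theory Defs
  imports "HOL-Analysis.Analysis" "HOL-Algebra.Group"
begin

definition sequential_space :: "'a::topological_space set \<Rightarrow> bool" where
  "sequential_space X \<longleftrightarrow>
     (\<forall>A\<subseteq>X. \<not> closedin (top_of_set X) A \<longrightarrow>
        (\<exists>(f :: nat \<Rightarrow> 'a) x. range f \<subseteq> A \<and> x \<in> X - A \<and> f \<longlonglongrightarrow> x))"

definition idempotents :: "'a::semigroup_mult set" where
  "idempotents = {e. e * e = e}"

definition submagma_at :: "'a::semigroup_mult \<Rightarrow> 'a set \<Rightarrow> 'a monoid" where
  "submagma_at e G = \<lparr>carrier = G, monoid.mult = (*), one = e\<rparr>"

text \<open>The greatest element with respect to inclusion exists whenever \<open>e\<close> is idempotent;
  see \<open>group_max_subgroup\<close> and \<open>max_subgroup_greatest\<close> below.\<close>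

definition max_subgroup :: "'a::semigroup_mult \<Rightarrow> 'a set" where
  "max_subgroup e = (GREATEST G. group (submagma_at e G))"

definition clifford_part :: "'a::semigroup_mult set" where
  "clifford_part = (\<Union>e\<in>idempotents. max_subgroup e)"

text \<open>The description is unique for \<open>x \<in> clifford_part\<close>, because distinct maximal subgroups
  are disjoint; see \<open>clifford_inv_eq\<close> below.\<close>

definition clifford_inv :: "'a::semigroup_mult \<Rightarrow> 'a" where
  "clifford_inv x =
     (THE y. \<exists>e\<in>idempotents. x \<in> max_subgroup e \<and> y = m_inv (submagma_at e (max_subgroup e)) x)"

definition clifford_proj :: "'a::semigroup_mult \<Rightarrow> 'a" where
  "clifford_proj x = x * clifford_inv x"

lemma group_submagma_at_iff:
  "group (submagma_at e G) \<longleftrightarrow>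
     e \<in> G \<and> (\<forall>x\<in>G. \<forall>y\<in>G. x * y \<in> G) \<and> (\<forall>x\<in>G. e * x = x \<and> x * e = x) \<and>
     (\<forall>x\<in>G. \<exists>y\<in>G. x * y = e \<and> y * x = e)" (is "?L \<longleftrightarrow> ?R")
proof
  assume ?L
  then interpret group "submagma_at e G" .
  show ?R
    using one_closed m_closed l_one r_one r_inv_ex l_inv_ex inv_closed r_inv l_inv
    by (simp add: submagma_at_def) metis
next
  assume ?R
  then show ?L
    by (intro groupI) (auto simp: submagma_at_def mult.assoc)
qed

definition local_units :: "'a::semigroup_mult \<Rightarrow> 'a set" where
  "local_units e = {x. e * x = x \<and> x * e = x \<and>
     (\<exists>y. e * y = y \<and> y * e = y \<and> x * y = e \<and> y * x = e)}"

lemma group_local_units: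
  assumes "e \<in> idempotents"
  shows "group (submagma_at e (local_units e))"
proof -
  have ee: "e * e = e"
    using assms by (simp add: idempotents_def)
  have "x * y \<in> local_units e" if xy: "x \<in> local_units e" "y \<in> local_units e" for x y
  proof -
    obtain x' where x': "e * x' = x'" "x' * e = x'" "x * x' = e" "x' * x = e"
      using xy by (auto simp: local_units_def)
    obtain y' where y': "e * y' = y'" "y' * e = y'" "y * y' = e" "y' * y = e"
      using xy by (auto simp: local_units_def)
    have e: "e * x = x" "x * e = x" "e * y = y" "y * e = y"
      using xy by (auto simp: local_units_def)
    have "e * (y' * x') = y' * x'" "(y' * x') * e = y' * x'"
      "(x * y) * (y' * x') = e" "(y' * x') * (x * y) = e"
      "e * (x * y) = x * y" "(x * y) * e = x * y"
      using x' y' e by (metis mult.assoc)+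
    then show ?thesis
      unfolding local_units_def by blast
  qed
  moreover have "\<exists>y\<in>local_units e. x * y = e \<and> y * x = e" if "x \<in> local_units e" for x
    using that unfolding local_units_def by blast
  moreover have "e \<in> local_units e"
    using ee by (auto simp: local_units_def)
  ultimately show ?thesis
    unfolding group_submagma_at_iff by (auto simp: local_units_def)
qed

lemma subset_local_units:
  assumes "group (submagma_at e G)"
  shows "G \<subseteq> local_units e"
  using assms unfolding group_submagma_at_iff local_units_def by blast

lemma max_subgroup_eq_local_units:
  assumes "e \<in> idempotents"
  shows "max_subgroup e = local_units e"
  unfolding max_subgroup_def
  by (rule Greatest_equality) (use assms group_local_units subset_local_units in auto)

lemma group_max_subgroup:
  "e \<in> idempotents \<Longrightarrow> group (submagma_at e (max_subgroup e))"
  by (simp add: max_subgroup_eq_local_units group_local_units)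

lemma max_subgroup_greatest:
  "e \<in> idempotents \<Longrightarrow> group (submagma_at e G) \<Longrightarrow> G \<subseteq> max_subgroup e"
  by (simp add: max_subgroup_eq_local_units subset_local_units)

lemma max_subgroup_disjoint:
  assumes "e \<in> idempotents" "f \<in> idempotents" "x \<in> max_subgroup e" "x \<in> max_subgroup f"
  shows "e = f"
proof -
  obtain y z where "e * x = x" "x * e = x" "x * y = e" "y * x = e"
    "f * x = x" "x * f = x" "x * z = f" "z * x = f"
    using assms by (auto simp: max_subgroup_eq_local_units local_units_def)
  then show ?thesis
    by (metis mult.assoc)
qed

lemma clifford_inv_eq:
  assumes "e \<in> idempotents" "x \<in> max_subgroup e"
  shows "clifford_inv x = m_inv (submagma_at e (max_subgroup e)) x"
  unfolding clifford_inv_def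
  by (rule the_equality) (use assms max_subgroup_disjoint in blast)+

lemma clifford_inv_props:
  assumes "e \<in> idempotents" "x \<in> max_subgroup e"
  shows "clifford_inv x \<in> max_subgroup e" "x * clifford_inv x = e" "clifford_inv x * x = e"
proof -
  interpret group "submagma_at e (max_subgroup e)"
    using assms(1) by (rule group_max_subgroup)
  show "clifford_inv x \<in> max_subgroup e" "x * clifford_inv x = e" "clifford_inv x * x = e"
    using inv_closed[of x] r_inv[of x] l_inv[of x] assms(2)
    by (simp_all add: clifford_inv_eq[OF assms] submagma_at_def)
qed

end

theory Submission
  imports Defs
begin

text \<open>A Hausdorff sequential countably compact space is sequentially compact. So if \<open>x\<^sub>n \<longlonglongrightarrow> x\<close>
  with each \<open>x\<^sub>n\<close> in a maximal subgroup, then some subsequence of the inverses converges to a point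
  \<open>y\<close>. The equations that say that \<open>x\<^sub>n\<close> and its inverse are mutually inverse in a subgroup pass to
  the limit, so \<open>x\<close> lies in the maximal subgroup of the idempotent \<open>x * y\<close> and has inverse \<open>y\<close>.
  Since closedness is sequential, everything follows.\<close>

lemma sequential_space_closedI:
  fixes A :: "'a::topological_space set"
  assumes "sequential_space (UNIV :: 'a set)"
    and "\<And>f x. (\<And>n. f n \<in> A) \<Longrightarrow> f \<longlonglongrightarrow> x \<Longrightarrow> x \<in> A"
  shows "closed A"
proof (rule ccontr)
  assume "\<not> closed A"
  then obtain f :: "nat \<Rightarrow> 'a" and x where "range f \<subseteq> A" "x \<notin> A" "f \<longlonglongrightarrow> x"
    using assms(1) by (force simp: sequential_space_def)
  then show False
    using assms(2)[of f x] by blast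
qed

lemma infinite_fibre_constant_subseq:
  fixes x :: "nat \<Rightarrow> 'a"
  assumes "infinite {n. x n = v}"
  obtains r where "strict_mono (r :: nat \<Rightarrow> nat)" "x \<circ> r = (\<lambda>_. v)"
proof
  show "strict_mono (enumerate {n. x n = v})"
    using assms by (rule strict_mono_enumerate)
  show "x \<circ> enumerate {n. x n = v} = (\<lambda>_. v)"
    using enumerate_in_set[OF assms] by auto
qed

text \<open>Countable compactness only yields an accumulation point \<open>a\<close> of an infinite
  range; sequentiality turns it into a convergent sequence of terms, possibly with another limit and
  out of order, and thinning restores the order.\<close>

lemma sequential_countably_compact_imp_seq_compact:
  assumes seq: "sequential_space (UNIV :: 'a::t2_space set)"
    and cc: "countably_compact (UNIV :: 'a set)"
  shows "seq_compact (UNIV :: 'a set)"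
  unfolding seq_compact_def
proof (intro allI impI)
  fix x :: "nat \<Rightarrow> 'a"
  show "\<exists>l\<in>UNIV. \<exists>r. strict_mono (r :: nat \<Rightarrow> nat) \<and> (x \<circ> r) \<longlonglongrightarrow> l"
  \<comment> \<open>A value taken infinitely often gives a constant subsequence; otherwise all
    fibres are finite, which forces an infinite range.\<close>
  proof (cases "\<exists>v. infinite {n. x n = v}")
    case True
    then obtain v where "infinite {n. x n = v}" by blast
    then obtain r :: "nat \<Rightarrow> nat" where "strict_mono r" "x \<circ> r = (\<lambda>_. v)"
      by (rule infinite_fibre_constant_subseq)
    then show ?thesis
      by (metis UNIV_I tendsto_const)
  next
    case False
    have "infinite (range x)"
    proof
      assume "finite (range x)"
      then obtain v where "infinite {n\<in>UNIV. x n = x v}"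
        using pigeonhole_infinite[of UNIV x] by auto
      then show False using False by auto
    qed
    moreover have "countable (range x)" by simp
    ultimately obtain a where a: "\<And>U. a \<in> U \<Longrightarrow> open U \<Longrightarrow> infinite (U \<inter> range x)"
      using countably_compact_imp_acc_point[OF cc, of "range x"] by blast
    \<comment> \<open>Were this set closed, its complement would be a neighbourhood of
      \<open>a\<close> meeting \<open>range x\<close> in at most \<open>a\<close>.\<close>
    have "\<not> closed (range x - {a})"
    proof
      assume "closed (range x - {a})"
      then have "infinite (- (range x - {a}) \<inter> range x)"
        by (intro a open_Compl) auto
      moreover have "- (range x - {a}) \<inter> range x \<subseteq> {a}" by blast
      ultimately show False
        using finite_subset by blast
    qed
    then obtain f :: "nat \<Rightarrow> 'a" and z
      where f: "range f \<subseteq> range x - {a}" "z \<notin> range x - {a}" "f \<longlonglongrightarrow> z"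
      using seq[unfolded sequential_space_def, rule_format, of "range x - {a}"] by auto
    then have "\<forall>k. \<exists>n. f k = x n" by blast
    then obtain n where n: "\<And>k. f k = x (n k)" by metis
    \<comment> \<open>The indices tend to infinity: the first terms other than \<open>a\<close> form
      a finite, hence closed, set that misses \<open>z\<close>. Deleting \<open>a\<close> matters,
      since \<open>z\<close> may equal \<open>a\<close>.\<close>
    have large: "eventually (\<lambda>k. n k > N) sequentially" for N
    proof -
      have "open (- (x ` {..N} - {a}))"
        by (intro open_Compl finite_imp_closed) simp
      moreover have "z \<in> - (x ` {..N} - {a})"
        using f(2) by blast
      ultimately have "eventually (\<lambda>k. f k \<in> - (x ` {..N} - {a})) sequentially"
        using f(3) topological_tendstoD by blast
      then show ?thesis
        by (rule eventually_mono) (use f(1) n in \<open>force simp: not_less\<close>)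
    qed
    \<comment> \<open>Growth of \<open>k\<close> keeps the limit \<open>z\<close> of
      \<open>f\<close>; growth of \<open>n k\<close> makes the result a subsequence of
      \<open>x\<close>.\<close>
    have "\<exists>k'. k < k' \<and> n k < n k'" for k
      using eventually_happens'[OF sequentially_bot
          eventually_conj[OF eventually_gt_at_top[of k] large[of "n k"]]] .
    then obtain s where s: "\<And>i. s i < s (Suc i)" "\<And>i. n (s i) < n (s (Suc i))"
      using dependent_nat_choice[of "\<lambda>_ _. True" "\<lambda>_ k k'. k < k' \<and> n k < n k'"] by auto
    have "(f \<circ> s) \<longlonglongrightarrow> z"
      using f(3) s(1) by (intro LIMSEQ_subseq_LIMSEQ) (auto simp: strict_mono_Suc_iff)
    then have "(x \<circ> (n \<circ> s)) \<longlonglongrightarrow> z"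
      by (simp add: o_def n)
    moreover have "strict_mono (n \<circ> s)"
      using s(2) by (simp add: strict_mono_Suc_iff)
    ultimately show ?thesis by blast
  qed
qed

text \<open>The first three equations do not mention the idempotent, so they survive limits along
  which the maximal subgroup varies.\<close>

lemma clifford_part_inv:
  fixes x :: "'a::semigroup_mult"
  assumes "x \<in> clifford_part"
  shows "x * clifford_inv x * x = x"
    "clifford_inv x * x * clifford_inv x = clifford_inv x"
    "x * clifford_inv x = clifford_inv x * x"
    "clifford_inv x \<in> clifford_part"
    "x * clifford_inv x \<in> idempotents"
proof -
  obtain e where e: "e \<in> idempotents" "x \<in> max_subgroup e"
    using assms by (auto simp: clifford_part_def)
  note p = clifford_inv_props[OF e]
  show "clifford_inv x \<in> clifford_part" "x * clifford_inv x \<in> idempotents"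
    using e p by (auto simp: clifford_part_def)
  have "e * x = x" "e * clifford_inv x = clifford_inv x"
    using e p by (auto simp: max_subgroup_eq_local_units local_units_def)
  then show "x * clifford_inv x * x = x"
    "clifford_inv x * x * clifford_inv x = clifford_inv x"
    "x * clifford_inv x = clifford_inv x * x"
    by (simp_all add: p)
qed

text \<open>The equations make \<open>x * y\<close> an idempotent that is a two-sided unit for both
  \<open>x\<close> and \<open>y\<close>, so the two are mutually inverse in its group of local
  units.\<close>

lemma clifford_partI:
  fixes x :: "'a::semigroup_mult"
  assumes "x * y * x = x" "y * x * y = y" "x * y = y * x"
  shows "x \<in> clifford_part" "clifford_inv x = y"
proof -
  have xy: "x * y \<in> idempotents"
    using assms by (simp add: idempotents_def flip: mult.assoc)
  have "x \<in> local_units (x * y)"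
  proof -
    have "x * (x * y) = x" "y * (x * y) = y" "(x * y) * y = y"
      using assms by (metis mult.assoc)+
    then show ?thesis
      using assms by (auto simp: local_units_def intro!: exI[of _ y])
  qed
  then have x: "x \<in> max_subgroup (x * y)"
    by (simp add: max_subgroup_eq_local_units xy)
  then show "x \<in> clifford_part"
    using xy by (auto simp: clifford_part_def)
  note p = clifford_inv_props[OF xy x]
  have "x * y * clifford_inv x = clifford_inv x"
    using p(1) by (simp add: max_subgroup_eq_local_units xy local_units_def)
  \<comment> \<open>With \<open>z = clifford_inv x\<close>:
    \<open>z = (x * y) * z = y * (x * z) = y * (x * y) = y\<close>.\<close>
  then show "clifford_inv x = y"
    by (metis assms(2,3) p(2) mult.assoc)
qed

text \<open>As fibres of the projection, maximal subgroups inherit closedness from its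
  continuity.\<close>

lemma max_subgroup_eq_clifford_proj:
  assumes "e \<in> idempotents"
  shows "max_subgroup e = clifford_part \<inter> clifford_proj -` {e}"
proof -
  have "clifford_proj x = f" if "f \<in> idempotents" "x \<in> max_subgroup f" for x f :: 'a
    using clifford_inv_props[OF that] by (simp add: clifford_proj_def)
  then show ?thesis
    using assms by (fastforce simp: clifford_part_def)
qed

lemma clifford_inv_subseq_tendsto:
  fixes x :: "nat \<Rightarrow> 'a::{t2_space, topological_semigroup_mult}"
  assumes sc: "seq_compact (UNIV :: 'a set)"
    and x: "\<And>n. x n \<in> clifford_part" and lim: "x \<longlonglongrightarrow> l"
  obtains r where "strict_mono (r :: nat \<Rightarrow> nat)" "l \<in> clifford_part"
    "(\<lambda>n. clifford_inv (x (r n))) \<longlonglongrightarrow> clifford_inv l"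
proof -
  obtain y r where r: "strict_mono (r :: nat \<Rightarrow> nat)" "(\<lambda>n. clifford_inv (x (r n))) \<longlonglongrightarrow> y"
    using sc[unfolded seq_compact_def, rule_format, of "clifford_inv \<circ> x"] by (auto simp: o_def)
  have xr: "(\<lambda>n. x (r n)) \<longlonglongrightarrow> l"
    using LIMSEQ_subseq_LIMSEQ[OF lim r(1)] by (simp add: o_def)
  note lims = tendsto_mult[OF xr r(2)] tendsto_mult[OF r(2) xr]
  have "l * y * l = l"
    using LIMSEQ_unique[OF tendsto_mult[OF lims(1) xr]] xr by (simp only: clifford_part_inv(1)[OF x])
  moreover have "y * l * y = y"
    using LIMSEQ_unique[OF tendsto_mult[OF lims(2) r(2)]] r(2) by (simp only: clifford_part_inv(2)[OF x])
  moreover have "l * y = y * l"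
    using LIMSEQ_unique[OF lims(1)] lims(2) by (simp only: clifford_part_inv(3)[OF x])
  ultimately have "l \<in> clifford_part" "clifford_inv l = y"
    by (rule clifford_partI)+
  then show thesis
    using that r by simp
qed

theorem corollary12:
  assumes "sequential_space (UNIV :: 'a::{t2_space, topological_semigroup_mult} set)"
    and "countably_compact (UNIV :: 'a set)"
  shows "(\<forall>e\<in>(idempotents :: 'a set). closed (max_subgroup e)) \<and>
    closed (clifford_part :: 'a set) \<and>
    continuous_map (top_of_set (clifford_part :: 'a set)) (top_of_set clifford_part) clifford_inv \<and>
    continuous_map (top_of_set (clifford_part :: 'a set)) (top_of_set idempotents) clifford_proj"
proof -
  note sc = sequential_countably_compact_imp_seq_compact[OF assms]
  have closed: "closed (clifford_part :: 'a set)"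
    by (rule sequential_space_closedI[OF assms(1)]) (rule clifford_inv_subseq_tendsto[OF sc])
  \<comment> \<open>Because \<open>clifford_part\<close> is closed, preimages of closed sets can be
    tested for closedness in the whole space by sequences; there convergence of the inverses along a
    subsequence suffices.\<close>
  have inv: "continuous_on (clifford_part :: 'a set) clifford_inv"
    unfolding continuous_on_closed_vimage[OF closed]
  proof (intro allI impI)
    fix B :: "'a set"
    assume B: "closed B"
    show "closed (clifford_inv -` B \<inter> clifford_part)"
    proof (rule sequential_space_closedI[OF assms(1)])
      fix f and x :: 'a
      assume f: "\<And>n. f n \<in> clifford_inv -` B \<inter> clifford_part" and lim: "f \<longlonglongrightarrow> x"
      obtain r :: "nat \<Rightarrow> nat" where r: "x \<in> clifford_part"
        "(\<lambda>n. clifford_inv (f (r n))) \<longlonglongrightarrow> clifford_inv x"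
        using clifford_inv_subseq_tendsto[OF sc _ lim] f by blast
      then have "clifford_inv x \<in> B"
        using closed_sequentially[OF B _ r(2)] f by auto
      with r show "x \<in> clifford_inv -` B \<inter> clifford_part" by simp
    qed
  qed
  have proj: "continuous_on (clifford_part :: 'a set) clifford_proj"
    unfolding clifford_proj_def by (intro continuous_intros inv)
  have "closed (max_subgroup e)" if "e \<in> idempotents" for e :: 'a
    unfolding max_subgroup_eq_clifford_proj[OF that]
    using continuous_closed_preimage[OF proj closed] by simp
  then show ?thesis
    using closed inv proj clifford_part_inv(4,5) by (auto simp: clifford_proj_def)
qed

end
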